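(* For every integer $k>1$, \[\sum_{j=1}^{k} C_j \frac{k!}{(k-j)!} = \frac{k}{k-1}.\]
   Context: Let $H_0=0$ and $H_\ell=\sum_{i=1}^{\ell}\frac{1}{i}$ for $\ell\ge 1$. For every integer $j\geq 1$, define $C_j=\frac{(-1)^j}{(j-1)!}H_{j-1}$. *)

theory Defs
  imports "HOL-Analysis.Harmonic_Numbers"
begin

text \<open>
  The coefficients are only meaningful for \<open>j \<ge> 1\<close>; \<open>harm 0 = 0\<close> matches \<open>H\<^sub>0 = 0\<close>.
\<close>

definition C :: "nat \<Rightarrow> real" where
  "C j = (-1) ^ j / fact (j - 1) * harm (j - 1)"

end

theory Submission
  imports Defs
begin

text \<open>
  With \<open>n = k - 1\<close> and \<open>i = j - 1\<close> the sum is \<open>- k\<close> times the \<open>n\<close>-th binomial transform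
  \<open>\<Sum>i. (-1)^i * (n choose i) * H\<^sub>i\<close>. One difference step turns \<open>H\<^sub>i\<close> into \<open>1 / (i + 1)\<close>, and absorbing
  this factor into the binomial coefficient leaves the alternating row sum without its first term.
\<close>

text \<open>Summation by parts: Pascal's rule splits each coefficient of row \<open>Suc m\<close>,
  and shifting the index in one half flips its sign, so the two halves combine into differences of
  \<open>f\<close>.\<close>

lemma alternating_choose_sum_Suc:
  fixes f :: "nat \<Rightarrow> 'a :: comm_ring_1"
  shows "(\<Sum>i\<le>Suc m. (-1) ^ i * of_nat (Suc m choose i) * f i) =
         (\<Sum>i\<le>m. (-1) ^ i * of_nat (m choose i) * (f i - f (Suc i)))"
proof -
  \<comment> \<open>Since \<open>m choose Suc m\<close> is 0, the range can grow by one; peeling off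
    \<open>f 0\<close> then leaves a sum over \<open>i \<le> m\<close> again, ready for Pascal's
    rule.\<close>
  have "(\<Sum>i\<le>m. (-1) ^ i * of_nat (m choose i) * f i) =
        (\<Sum>i\<le>Suc m. (-1) ^ i * of_nat (m choose i) * f i)"
    by (simp add: binomial_eq_0)
  also have "\<dots> = f 0 + (\<Sum>i\<le>m. (-1) ^ Suc i * of_nat (m choose Suc i) * f (Suc i))"
    by (subst sum.atMost_Suc_shift) simp
  finally have "(\<Sum>i\<le>m. (-1) ^ i * of_nat (m choose i) * (f i - f (Suc i))) =
      f 0 + (\<Sum>i\<le>m. (-1) ^ Suc i * of_nat (Suc m choose Suc i) * f (Suc i))"
    by (simp add: algebra_simps sum.distrib sum_subtractf sum_negf)
  also have "\<dots> = (\<Sum>i\<le>Suc m. (-1) ^ i * of_nat (Suc m choose i) * f i)"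
    by (subst sum.atMost_Suc_shift) simp
  finally show ?thesis ..
qed

lemma alternating_choose_sum_inverse_Suc:
  "(\<Sum>i\<le>m. (-1) ^ i * of_nat (m choose i) / of_nat (Suc i)) =
   (1 / of_nat (Suc m) :: 'a :: field_char_0)"
proof -
  have absorb: "of_nat (m choose i) / of_nat (Suc i) =
      (of_nat (Suc m choose Suc i) / of_nat (Suc m) :: 'a)" for i
  proof -
    have "of_nat (Suc i * (Suc m choose Suc i)) = (of_nat (Suc m * (m choose i)) :: 'a)"
      by (simp only: Suc_times_binomial)
    then show ?thesis
      unfolding of_nat_mult by (simp add: frac_eq_eq mult.commute del: of_nat_Suc binomial_Suc_Suc)
  qed
  have "(\<Sum>i\<le>Suc m. (-1) ^ i * of_nat (Suc m choose i) :: 'a) = 0"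
    by (rule choose_alternating_sum) simp
  \<comment> \<open>The dropped term of index 0 is 1, and the shift reverses every sign, so the rest
    sums to 1 rather than -1.\<close>
  then have "(\<Sum>i\<le>m. (-1) ^ i * of_nat (Suc m choose Suc i) :: 'a) = 1"
    by (subst (asm) sum.atMost_Suc_shift)
       (simp add: sum_negf del: binomial_Suc_Suc sum.atMost_Suc)
  then show ?thesis
    by (simp only: times_divide_eq_right [symmetric] absorb)
       (simp only: times_divide_eq_right sum_divide_distrib [symmetric])
qed

lemma alternating_choose_sum_harm:
  assumes "n > 0"
  shows "(\<Sum>i\<le>n. (-1) ^ i * of_nat (n choose i) * harm i) =
         (- 1 / of_nat n :: 'a :: real_normed_field)"
proof -
  obtain m where n: "n = Suc m"
    using assms gr0_implies_Suc by blast
  \<comment> \<open>The minus sign comes from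
    \<open>harm i - harm (Suc i) = - 1 / (i + 1)\<close>.\<close>
  have "(\<Sum>i\<le>n. (-1) ^ i * of_nat (n choose i) * harm i) =
        - (\<Sum>i\<le>m. (-1) ^ i * of_nat (m choose i) / of_nat (Suc i) :: 'a)"
    unfolding n alternating_choose_sum_Suc
    by (simp add: harm_Suc sum_negf field_class.field_divide_inverse del: of_nat_Suc)
  then show ?thesis
    by (simp add: n alternating_choose_sum_inverse_Suc del: of_nat_Suc)
qed

theorem theorem2p9:
  fixes k :: nat
  assumes "k > 1"
  shows "(\<Sum>j=1..k. C j * (fact k / fact (k - j))) = real k / (real k - 1)"
proof -
  define n where "n = k - 1"
  have k: "k = Suc n" and "n > 0"
    using assms by (auto simp: n_def)
  have "(\<Sum>j=1..k. C j * (fact k / fact (k - j))) =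
        (\<Sum>i\<le>n. C (Suc i) * (fact k / fact (n - i)))"
    by (simp only: k One_nat_def sum.shift_bounds_cl_Suc_ivl atLeast0AtMost diff_Suc_Suc)
  \<comment> \<open>Here \<open>fact k = k * fact n\<close>, and the \<open>fact i\<close> in the
    denominator of \<open>C (Suc i)\<close> completes \<open>n choose i\<close>; the sign is
    \<open>(-1) ^ Suc i\<close>.\<close>
  also have "\<dots> = (\<Sum>i\<le>n. - real k * ((-1) ^ i * real (n choose i) * harm i))"
    by (intro sum.cong refl) (simp add: C_def k binomial_fact field_simps)
  also have "\<dots> = - real k * (- 1 / real n)"
    using \<open>n > 0\<close> by (simp only: sum_distrib_left [symmetric] alternating_choose_sum_harm)
  also have "\<dots> = real k / (real k - 1)"
    using \<open>n > 0\<close> by (simp add: k field_simps)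
  finally show ?thesis .
qed

end
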